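(* Let $G$ be a graph with $m$ edges and $\lambda(G)>\sqrt m$. Then $$\operatorname{bk}(G)>\frac14\sqrt m .$$
   Context: Graphs are finite and simple. $\lambda(G)$ is the largest eigenvalue of the adjacency matrix of $G$. A book of size $k$, denoted $B_k$, is the graph consisting of $k$ triangles sharing a common edge, and $\operatorname{bk}(G)$ is the largest $k$ such that $G$ contains a copy of $B_k$ as a (not necessarily induced) subgraph; equivalently, the maximum over edges $uv$ of $G$ of the number of common neighbors of $u$ and $v$. *)

theory Defs
  imports "HOL-Analysis.Analysis"
begin

text \<open>
  A finite simple graph is given by its set of edges, each a two-element set of vertices.
  The vertex set is the whole type \<open>'a\<close>; in the matrix notions below \<open>'a\<close> is finite.
\<close>

definition simple_graph :: "'a set set \<Rightarrow> bool" where
  "simple_graph E \<longleftrightarrow> (\<forall>e\<in>E. card e = 2)"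

definition adjacency_matrix :: "'a::finite set set \<Rightarrow> real ^ 'a ^ 'a" where
  "adjacency_matrix E = (\<chi> u v. if {u, v} \<in> E then 1 else 0)"

definition is_eigenvalue :: "real ^ 'n ^ 'n \<Rightarrow> real \<Rightarrow> bool" where
  "is_eigenvalue A c \<longleftrightarrow> (\<exists>x. x \<noteq> 0 \<and> A *v x = c *\<^sub>R x)"

text \<open>
  The adjacency matrix is real symmetric, so its real eigenvalues are all its eigenvalues
  and the maximum is taken over a finite nonempty set.
\<close>

definition largest_eigenvalue :: "'a::finite set set \<Rightarrow> real" where
  "largest_eigenvalue E = Max {c. is_eigenvalue (adjacency_matrix E) c}"

text \<open>
  The edges of the book \<open>B\<^sub>k\<close>: its vertices are \<open>0, \<dots>, k + 1\<close>, the common edge of the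
  triangles is \<open>{0, 1}\<close>, and \<open>2, \<dots>, k + 1\<close> are their third vertices.
  In particular \<open>B\<^sub>0\<close> is a single edge.
\<close>

definition book :: "nat \<Rightarrow> nat set set" where
  "book k = insert {0, 1} (\<Union>i\<in>{2..<k + 2}. {{0, i}, {1, i}})"

text \<open>Not necessarily induced. The graph \<open>F\<close> is taken to have no isolated vertices.\<close>

definition contains_copy :: "'a set set \<Rightarrow> 'b set set \<Rightarrow> bool" where
  "contains_copy E F \<longleftrightarrow> (\<exists>f. inj_on f (\<Union>F) \<and> (\<forall>e\<in>F. f ` e \<in> E))"

text \<open>
  Unspecified for an edgeless graph, which contains no book at all; as \<open>'a\<close> is finite, the set
  below is always finite.
\<close>

definition bk :: "'a::finite set set \<Rightarrow> nat" where
  "bk E = Max {k. contains_copy E (book k)}"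

end

theory Submission
  imports Defs
begin

text \<open>
  Write \<open>\<lambda>\<close> for the largest eigenvalue, \<open>b\<close> for the book number, and let \<open>x \<ge> 0\<close> be an
  eigenvector for \<open>\<lambda>\<close>, scaled so that its largest entry is \<open>x u = 1\<close>. The claim follows once
  \<open>\<lambda>\<^sup>2 > m\<close> is shown to force \<open>\<lambda> < 4 b\<close>.

  Let \<open>N\<close> be the neighbourhood of \<open>u\<close>, let \<open>Z\<close> be the set of the vertices that are neither \<open>u\<close>
  nor in \<open>N\<close>, and let \<open>R\<close> be the total weight \<open>\<Sum>z\<in>Z. x z\<close>. A vertex \<open>y\<close> of \<open>N\<close> sees a part
  \<open>\<rho> y\<close> of this weight; its deficit is \<open>R - \<rho> y \<ge> 0\<close>. The excess of an edge \<open>y y'\<close> inside \<open>N\<close>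
  is \<open>x y + x y' - 1\<close>. Two estimates pull the deficits in opposite directions.

  \<^item> Deficits are small. Expanding \<open>\<lambda>\<^sup>2 = \<lambda>\<^sup>2 x u\<close> along walks of length two from \<open>u\<close> and
    comparing with the number \<open>m\<close> of edges shows that the edges inside \<open>N\<close> have positive total
    excess, enough to pay \<open>1\<close> for every edge inside \<open>Z\<close> and \<open>1 - x z\<close> for every edge between \<open>N\<close>
    and a vertex \<open>z\<close> of \<open>Z\<close>. Together with the expansion of \<open>\<lambda> R\<close> this bounds the weighted
    deficit \<open>\<Sum>y\<in>N. x y * (R - \<rho> y)\<close> by twice the total excess (\<open>deficit_less_excess\<close>).

  \<^item> Deficits are large. The ends of an edge inside \<open>N\<close> have the common neighbour \<open>u\<close>, hence at
    most \<open>b - 1\<close> common neighbours in \<open>Z\<close>, so their deficits add up to at least \<open>R + 1 - b\<close>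
    (\<open>\<rho>_edge\<close>).

  To play the two against each other, the second estimate is summed over the edges inside \<open>N\<close>,
  each weighted with the positive part of its excess. Every vertex of \<open>N\<close> has at most \<open>b\<close>
  neighbours in \<open>N\<close>, because \<open>u\<close> is adjacent to all of \<open>N\<close>. If \<open>X\<close> is the largest weight of an
  end of an edge inside \<open>N\<close> and \<open>\<phi>\<close> is the largest excess, then the excess of an edge at \<open>y\<close>
  is at most \<open>\<phi> / (\<phi> + 1 - X)\<close> times \<open>x y\<close>, and the result is
  \<open>R + 1 - b < 2 b \<phi> / (\<phi> + 1 - X)\<close>. The eigenvalue equation at a vertex of weight \<open>X\<close> and
  at the ends of an edge of excess \<open>\<phi>\<close> bounds \<open>R\<close> from below in terms of \<open>\<lambda>\<close>, and these three
  inequalities are contradictory when \<open>\<lambda> \<ge> 4 b\<close> (\<open>quarter_bound_arith\<close>).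
\<close>

section \<open>Eigenvalues of symmetric matrices\<close>

lemma symmetric_matrix_inner:
  fixes A :: "real ^ 'n ^ 'n"
  assumes "transpose A = A"
  shows "v \<bullet> (A *v w) = (A *v v) \<bullet> w"
  using dot_lmul_matrix[of v A w] assms by (metis transpose_matrix_vector)

text \<open>
  Eigenvectors of distinct eigenvalues are orthogonal, and the dimension bounds the number of
  pairwise orthogonal nonzero vectors. Finiteness is what makes \<open>Max\<close> in \<open>largest_eigenvalue\<close>
  an actual eigenvalue.
\<close>

lemma finite_eigenvalues_symmetric:
  fixes A :: "real ^ 'n ^ 'n"
  assumes A: "transpose A = A"
  shows "finite {c. is_eigenvalue A c}"
proof -
  let ?C = "{c. is_eigenvalue A c}"
  obtain e where e: "\<And>c. c \<in> ?C \<Longrightarrow> e c \<noteq> 0 \<and> A *v e c = c *\<^sub>R e c"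
    using bchoice[of ?C "\<lambda>c v. v \<noteq> 0 \<and> A *v v = c *\<^sub>R v"] by (auto simp: is_eigenvalue_def)
  have orth: "e c \<bullet> e d = 0" if "c \<in> ?C" "d \<in> ?C" "c \<noteq> d" for c d
    using symmetric_matrix_inner[OF A, of "e c" "e d"] e[OF that(1)] e[OF that(2)] that(3) by simp
  have inj: "inj_on e ?C"
    by (rule inj_onI) (metis e orth inner_eq_zero_iff)
  have "pairwise orthogonal (e ` ?C)" "0 \<notin> e ` ?C"
    using orth e by (auto simp: pairwise_def orthogonal_def)
  then have "finite (e ` ?C)"
    using pairwise_orthogonal_independent finiteI_independent by blast
  then show ?thesis using inj finite_imageD by blast
qed

text \<open>
  The part of the Perron--Frobenius theorem that symmetric matrices make easy: a maximizer of the
  quadratic form on the unit sphere is an eigenvector whose eigenvalue bounds all others, and for a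
  nonnegative matrix the form does not decrease when the entries of the vector are replaced by
  their absolute values.
\<close>

lemma nonneg_eigenvector_exists:
  fixes A :: "real ^ 'n ^ 'n"
  assumes A: "transpose A = A" and nonneg: "\<And>i j. 0 \<le> A $ i $ j"
  obtains c z where "z \<noteq> 0" "\<And>i. 0 \<le> z $ i" "A *v z = c *\<^sub>R z"
    "\<And>d. is_eigenvalue A d \<Longrightarrow> d \<le> c"
proof -
  define Q where "Q v = v \<bullet> (A *v v)" for v
  have "continuous_on (sphere 0 1) Q"
    unfolding Q_def by (intro continuous_intros matrix_vector_mult_linear_continuous_on)
  moreover have "sphere 0 1 \<noteq> ({} :: (real ^ 'n) set)" by simp
  ultimately obtain y where y: "norm y = 1" "\<And>v. norm v = 1 \<Longrightarrow> Q v \<le> Q y"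
    using continuous_attains_sup[of "sphere 0 1" Q] by auto
  define z where "z = (\<chi> i. \<bar>y $ i\<bar>)"
  have Q_sum: "Q v = (\<Sum>i\<in>UNIV. \<Sum>j\<in>UNIV. A $ i $ j * (v $ i * v $ j))" for v
    by (simp add: Q_def inner_vec_def matrix_vector_mult_def sum_distrib_left mult_ac)
  have "norm z = 1" using y(1) by (simp add: z_def norm_vec_def)
  have "Q y \<le> Q z"
    unfolding Q_sum
  proof (intro sum_mono mult_left_mono nonneg)
    fix i j show "y $ i * y $ j \<le> z $ i * z $ j"
      by (simp add: z_def flip: abs_mult)
  qed
  define c where "c = Q z"
  have bound: "Q v \<le> c * (v \<bullet> v)" for v
  proof (cases "v = 0")
    case False
    have "Q v = (norm v)\<^sup>2 * Q ((1 / norm v) *\<^sub>R v)"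
      using False by (simp add: Q_def matrix_vector_mult_scaleR power2_eq_square)
    also have "\<dots> \<le> (norm v)\<^sup>2 * c"
      using y(2)[of "(1 / norm v) *\<^sub>R v"] \<open>Q y \<le> Q z\<close> False
      by (intro mult_left_mono) (auto simp: c_def)
    finally show ?thesis by (simp add: power2_norm_eq_inner mult.commute)
  qed (simp add: Q_def)
  \<comment> \<open>The form \<open>c * (v \<bullet> v) - Q v\<close> is nonnegative and vanishes at \<open>z\<close>, so it has no
    first-order term there; perturbing \<open>z\<close> along the residual \<open>w\<close> shows \<open>w = 0\<close>.\<close>
  define w where "w = c *\<^sub>R z - A *v z"
  define g where "g = c * (w \<bullet> w) - Q w"
  have "0 \<le> g" using bound[of w] by (simp add: g_def)
  have zz: "z \<bullet> z = 1" using \<open>norm z = 1\<close> by (simp add: norm_eq_1)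
  have quad: "0 \<le> 2 * t * (w \<bullet> w) + t\<^sup>2 * g" for t
  proof -
    have "Q (z + t *\<^sub>R w) = c + 2 * t * (w \<bullet> (A *v z)) + t\<^sup>2 * Q w"
      using symmetric_matrix_inner[OF A, of z w]
      by (simp add: Q_def c_def matrix_vector_right_distrib matrix_vector_mult_scaleR inner_add
          inner_commute power2_eq_square algebra_simps)
    moreover have "c * ((z + t *\<^sub>R w) \<bullet> (z + t *\<^sub>R w))
        = c + 2 * t * (w \<bullet> (c *\<^sub>R z)) + t\<^sup>2 * (c * (w \<bullet> w))"
      using zz by (simp add: inner_add inner_commute power2_eq_square algebra_simps)
    moreover have "w \<bullet> (c *\<^sub>R z) = w \<bullet> w + w \<bullet> (A *v z)"
      by (simp add: w_def inner_diff_right)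
    ultimately have "c + 2 * t * (w \<bullet> (A *v z)) + t\<^sup>2 * Q w
        \<le> c + 2 * t * (w \<bullet> w + w \<bullet> (A *v z)) + t\<^sup>2 * (c * (w \<bullet> w))"
      using bound[of "z + t *\<^sub>R w"] by metis
    then show ?thesis by (simp add: g_def algebra_simps)
  qed
  have "w = 0"
  proof (rule ccontr)
    assume "w \<noteq> 0"
    then have W: "0 < w \<bullet> w" by simp
    \<comment> \<open>For a small step against \<open>w\<close> the first-order term dominates; \<open>g + 1\<close> avoids dividing by
      \<open>g = 0\<close>.\<close>
    define t where "t = w \<bullet> w / (g + 1)"
    have "0 < t" using W \<open>0 \<le> g\<close> by (simp add: t_def)
    moreover have "0 \<le> t * (t * g - 2 * (w \<bullet> w))"
      using quad[of "- t"] by (simp add: power2_eq_square right_diff_distrib mult_ac)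
    ultimately have "2 * (w \<bullet> w) \<le> t * g" by (simp add: zero_le_mult_iff)
    also have "t * g \<le> w \<bullet> w" using W \<open>0 \<le> g\<close> by (simp add: t_def field_simps)
    finally show False using W by simp
  qed
  then have "A *v z = c *\<^sub>R z" by (simp add: w_def)
  moreover have "d \<le> c" if d: "is_eigenvalue A d" for d
  proof -
    obtain v where v: "v \<noteq> 0" "A *v v = d *\<^sub>R v" using d by (auto simp: is_eigenvalue_def)
    then have "d * (v \<bullet> v) \<le> c * (v \<bullet> v)" using bound[of v] by (simp add: Q_def)
    then show ?thesis using v(1) by simp
  qed
  moreover have "z \<noteq> 0" using \<open>norm z = 1\<close> by auto
  moreover have "0 \<le> z $ i" for i by (simp add: z_def)
  ultimately show thesis using that by blast
qed

section \<open>Books and codegrees\<close>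

lemma Union_book: "\<Union> (book k) = {..<k + 2}"
proof
  show "\<Union> (book k) \<subseteq> {..<k + 2}" by (auto simp: book_def)
  show "{..<k + 2} \<subseteq> \<Union> (book k)"
  proof
    fix i assume "i \<in> {..<k + 2}"
    then consider "i = 0" | "i = 1" | "i \<in> {2..<k + 2}" by fastforce
    then show "i \<in> \<Union> (book k)" by cases (auto simp: book_def)
  qed
qed

lemma finite_books: "finite {k. contains_copy (E :: 'a::finite set set) (book k)}"
proof (rule finite_subset)
  show "{k. contains_copy E (book k)} \<subseteq> {..CARD('a)}"
  proof
    fix k assume "k \<in> {k. contains_copy E (book k)}"
    then obtain f :: "nat \<Rightarrow> 'a" where "inj_on f {..<k + 2}"
      by (auto simp: contains_copy_def Union_book)
    then have "k + 2 \<le> CARD('a)" using card_inj_on_le[of f "{..<k + 2}" UNIV] by simp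
    then show "k \<in> {..CARD('a)}" by simp
  qed
qed simp

text \<open>
  The common neighbours of the ends of an edge are the third vertices of a book with that edge as
  its common edge.
\<close>

lemma codegree_le_bk:
  fixes E :: "'a::finite set set"
  assumes E: "simple_graph E" and vw: "{v, w} \<in> E"
  shows "card {z. {v, z} \<in> E \<and> {w, z} \<in> E} \<le> bk E"
proof -
  let ?C = "{z. {v, z} \<in> E \<and> {w, z} \<in> E}"
  define k where "k = card ?C"
  have loop: "{y} \<notin> E" for y using E by (force simp: simple_graph_def)
  then have "v \<noteq> w" using vw by auto
  have "card {2..<k + 2} = card ?C" by (simp add: k_def)
  then obtain h where h: "bij_betw h {2..<k + 2} ?C"
    using finite_same_card_bij[of "{2..<k + 2}" ?C] by auto
  define f where "f i = (if i = 0 then v else if i = 1 then w else h i)" for i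
  have hC: "{v, h i} \<in> E" "{w, h i} \<in> E" if "i \<in> {2..<k + 2}" for i
    using bij_betwE[OF h] that by auto
  have "inj_on f {2..<k + 2}"
    using bij_betw_imp_inj_on[OF h] by (simp add: f_def inj_on_def)
  moreover have "v \<notin> f ` {2..<k + 2}" "w \<notin> f ` {2..<k + 2}"
    using hC loop by (force simp: f_def)+
  moreover have f01: "f 0 = v" "f 1 = w" by (simp_all add: f_def)
  moreover have "{..<k + 2} = insert 0 (insert 1 {2..<k + 2})" by auto
  ultimately have "inj_on f {..<k + 2}"
    using \<open>v \<noteq> w\<close> by (simp add: inj_on_insert)
  moreover have "f ` e \<in> E" if e: "e \<in> book k" for e
  proof -
    consider "e = {0, 1}" | i where "i \<in> {2..<k + 2}" "e = {0, i} \<or> e = {1, i}"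
      using e unfolding book_def by blast
    then show ?thesis
    proof cases
      case 1
      then show ?thesis using vw f01 by simp
    next
      case (2 i)
      then have "f i = h i" by (simp add: f_def)
      then show ?thesis using 2(2) hC[OF 2(1)] f01 by auto
    qed
  qed
  ultimately have "contains_copy E (book k)"
    unfolding contains_copy_def Union_book by (intro exI[of _ f]) simp
  then show ?thesis unfolding bk_def k_def[symmetric] by (intro Max_ge finite_books) simp
qed

lemma sum_adjacency:
  fixes E :: "'a::finite set set"
  assumes E: "simple_graph E"
  shows "(\<Sum>v\<in>UNIV. \<Sum>w\<in>UNIV. of_bool ({v, w} \<in> E)) = 2 * real (card E)"
proof -
  let ?D = "\<lambda>e. {(v, w). {v, w} = (e :: 'a set)}"
  have "(\<Sum>v\<in>UNIV. \<Sum>w\<in>UNIV. of_bool ({v, w} \<in> E))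
      = (\<Sum>(v, w)\<in>UNIV. of_bool ({v, w} \<in> E) :: real)"
    by (simp only: sum.cartesian_product UNIV_Times_UNIV)
  also have "\<dots> = real (card {(v, w). {v, w} \<in> E})"
    by (simp add: case_prod_unfold of_bool_def sum.If_cases)
  also have "{(v, w). {v, w} \<in> E} = (\<Union>e\<in>E. ?D e)" by auto
  also have "card \<dots> = (\<Sum>e\<in>E. card (?D e))" by (rule card_UN_disjoint) auto
  also have "\<dots> = (\<Sum>e\<in>E. 2)"
  proof (rule sum.cong)
    fix e assume "e \<in> E"
    then obtain s t where st: "e = {s, t}" "s \<noteq> t"
      using E by (auto simp: simple_graph_def card_2_iff)
    then have "?D e = {(s, t), (t, s)}" by (auto simp: doubleton_eq_iff)
    then show "card (?D e) = 2" using st by simp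
  qed simp
  finally show ?thesis by simp
qed


section \<open>Eigenvalue and codegrees\<close>

text \<open>
  Here \<open>p\<close> is the largest excess \<open>\<phi>\<close> and \<open>R\<close> stands for \<open>R + 1\<close>. After scaling by \<open>b\<close> and setting
  \<open>s = p + 1 - X\<close>, a value \<open>lam \<ge> 4 * b\<close> turns the bounds \<open>i\<close> and \<open>iii\<close> into
  \<open>(s - p) * (2 - 3 * s) < 0\<close>, so \<open>s > 2 / 3\<close>, and \<open>ii\<close> and \<open>iii\<close> into \<open>(p + s) * s < p\<close>, which
  would then need \<open>p > 4 / 3\<close>.
\<close>

lemma quarter_bound_arith:
  fixes b X p R lam :: real
  assumes b: "0 < b" and X: "X \<le> 1" and p: "0 < p" "p \<le> 1"
    and i: "(lam - b) * X \<le> R" and X0: "0 \<le> X" and ii: "lam * (1 + p) \<le> R + b + 2 * b * X"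
    and iii: "R - b < 2 * b * (p / (p + 1 - X))"
  shows "lam < 4 * b"
proof (rule ccontr)
  assume "\<not> lam < 4 * b"
  then have lam: "4 * b \<le> lam" by simp
  define s where "s = p + 1 - X"
  have s: "0 < s" using X p by (simp add: s_def)
  have Rs: "(R - b) * s < b * (2 * p)"
    using iii s unfolding s_def[symmetric] by (simp add: field_simps)
  have "3 * b * X \<le> R"
    using i mult_right_mono[OF lam X0] by (simp add: algebra_simps)
  then have "b * (3 * X - 1) * s \<le> (R - b) * s"
    using s by (intro mult_right_mono) (simp_all add: algebra_simps)
  then have "b * (3 * X - 1) * s < b * (2 * p)" using Rs by linarith
  then have 1: "(3 * X - 1) * s < 2 * p" using b by (simp add: mult.assoc)
  have "4 * b * (1 + p) \<le> R + b + 2 * b * X"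
    using ii mult_right_mono[OF lam, of "1 + p"] p by linarith
  then have "b * (2 + 4 * p - 2 * X) * s \<le> (R - b) * s"
    using s by (intro mult_right_mono) (simp_all add: algebra_simps)
  then have "b * (2 + 4 * p - 2 * X) * s < b * (2 * p)" using Rs by linarith
  then have 2: "(2 + 4 * p - 2 * X) * s < 2 * p" using b by (simp add: mult.assoc)
  have X': "X = p + 1 - s" by (simp add: s_def)
  have "(s - p) * (2 - 3 * s) < 0"
    using 1 unfolding X' by (simp add: algebra_simps)
  then have "2 / 3 < s"
    using X mult_nonneg_nonneg[of "s - p" "2 - 3 * s"] unfolding X' by linarith
  moreover have "(p + s) * s < p"
    using 2 unfolding X' by (simp add: algebra_simps)
  moreover have "(p + 2 / 3) * (2 / 3) \<le> (p + s) * s"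
    using \<open>2 / 3 < s\<close> p by (intro mult_mono) auto
  ultimately show False using p by (simp add: algebra_simps)
qed

text \<open>
  The function \<open>a\<close> is the adjacency matrix, so the double sum of its entries is twice the number of
  edges; keeping it real-valued lets all counting be done by exchanging sums.
\<close>

locale perron_graph =
  fixes a :: "'a::finite \<Rightarrow> 'a \<Rightarrow> real" and x :: "'a \<Rightarrow> real" and lam b :: real and u :: 'a
  assumes a01: "a v w = 0 \<or> a v w = 1"
    and sym: "a v w = a w v"
    and irrefl: "a v v = 0"
    and x_nonneg: "0 \<le> x v" and x_le_1: "x v \<le> 1" and x_u: "x u = 1"
    and eigen: "(\<Sum>w\<in>UNIV. a v w * x w) = lam * x v"
    and codegree: "a v w = 1 \<Longrightarrow> (\<Sum>z\<in>UNIV. a v z * a w z) \<le> b"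
    and few_edges: "(\<Sum>v\<in>UNIV. \<Sum>w\<in>UNIV. a v w) < 2 * lam\<^sup>2"
begin

definition N where "N = {y. a u y = 1}"
definition Z where "Z = {z. a u z = 0 \<and> z \<noteq> u}"
definition R where "R = (\<Sum>z\<in>Z. x z)"
definition \<mu> where "\<mu> y = (\<Sum>z\<in>N. a y z * x z)"
definition \<rho> where "\<rho> y = (\<Sum>z\<in>Z. a y z * x z)"
definition excess where "excess y y' = x y + x y' - 1"

lemma a_nonneg: "0 \<le> a v w" and a_le_1: "a v w \<le> 1"
  using a01[of v w] by auto

lemma sum_split: "(\<Sum>v\<in>UNIV. g v) = g u + (\<Sum>v\<in>N. g v) + (\<Sum>v\<in>Z. g v)" for g :: "'a \<Rightarrow> real"
proof -
  have U: "(UNIV :: 'a set) = insert u (N \<union> Z)"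
    using a01[of u] by (auto simp: N_def Z_def)
  have "u \<notin> N \<union> Z" "N \<inter> Z = {}" using irrefl[of u] by (auto simp: N_def Z_def)
  then show ?thesis unfolding U by (simp add: sum.union_disjoint)
qed

lemma a_u: "y \<in> N \<Longrightarrow> a y u = 1" "z \<in> Z \<Longrightarrow> a z u = 0"
  using sym[of _ u] by (auto simp: N_def Z_def)

lemma sum_N: "(\<Sum>y\<in>N. x y) = lam"
proof -
  have "(\<Sum>w\<in>N. a u w * x w) = (\<Sum>w\<in>N. x w)" "(\<Sum>w\<in>Z. a u w * x w) = 0"
    by (simp_all add: N_def Z_def)
  then show ?thesis
    using eigen[of u] sum_split[of "\<lambda>w. a u w * x w"] by (simp add: irrefl x_u)
qed

lemma eigen_N: "y \<in> N \<Longrightarrow> lam * x y = 1 + \<mu> y + \<rho> y"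
  using eigen[of y] sum_split[of "\<lambda>w. a y w * x w"] by (simp add: a_u x_u \<mu>_def \<rho>_def)

lemma \<rho>_le_R: "\<rho> y \<le> R"
  unfolding \<rho>_def R_def
  by (intro sum_mono) (simp add: a_le_1 x_nonneg mult_left_le_one_le a_nonneg)

lemma sum_swap: "(\<Sum>y\<in>A. \<Sum>y'\<in>A. a y y' * g y') = (\<Sum>y\<in>A. \<Sum>y'\<in>A. a y y' * g y)"
  for g :: "'a \<Rightarrow> real"
proof -
  have "(\<Sum>y\<in>A. \<Sum>y'\<in>A. a y y' * g y') = (\<Sum>y'\<in>A. \<Sum>y\<in>A. a y y' * g y')" by (rule sum.swap)
  then show ?thesis by (simp add: sym)
qed

text \<open>
  The sum on the right runs over ordered pairs and so counts the excess of every edge inside \<open>N\<close>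
  twice. Let \<open>p - P\<close> be the weight that the edges between \<open>N\<close> and \<open>Z\<close> lose because
  \<open>x z \<le> 1\<close> at their ends in \<open>Z\<close>. The condition \<open>m < lam\<^sup>2\<close> says that the total excess exceeds
  \<open>p - P\<close> plus the number of edges inside \<open>Z\<close>. On the other side, the deficit is
  \<open>lam * R - (\<Sum>y\<in>N. x y * \<rho> y)\<close>, and expanding \<open>lam * R\<close> over the edges at \<open>Z\<close> shows that it is
  at most \<open>p - P\<close> plus twice the number of edges inside \<open>Z\<close>.
\<close>

lemma deficit_less_excess:
  "(\<Sum>y\<in>N. x y * (R - \<rho> y)) < (\<Sum>y\<in>N. \<Sum>y'\<in>N. a y y' * excess y y')"
proof -
  \<comment> \<open>Each edge inside \<open>N\<close> contributes \<open>2\<close> to \<open>q\<close>, each edge inside \<open>Z\<close> contributes \<open>2\<close> to \<open>r\<close>,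
    and each edge between them contributes \<open>1\<close> to \<open>p\<close>.\<close>
  define d where "d = (\<Sum>y\<in>N. 1 :: real)"
  define q where "q = (\<Sum>y\<in>N. \<Sum>y'\<in>N. a y y')"
  define r where "r = (\<Sum>z\<in>Z. \<Sum>z'\<in>Z. a z z')"
  define p where "p = (\<Sum>y\<in>N. \<Sum>z\<in>Z. a y z)"
  define P where "P = (\<Sum>y\<in>N. \<rho> y)"
  have p': "(\<Sum>z\<in>Z. \<Sum>y\<in>N. a z y) = p"
    unfolding p_def by (subst sum.swap) (simp add: sym)
  have ua: "(\<Sum>w\<in>N. a u w) = d" "(\<Sum>w\<in>Z. a u w) = 0"
    by (simp_all add: N_def Z_def d_def)
  have "(\<Sum>v\<in>UNIV. \<Sum>w\<in>UNIV. a v w) = 2 * d + q + 2 * p + r"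
    by (simp add: sum_split sum.distrib irrefl a_u ua p' flip: q_def r_def p_def)
       (simp add: d_def)
  then have edges: "2 * d + q + 2 * p + r < 2 * lam\<^sup>2" using few_edges by simp
  have "lam\<^sup>2 = (\<Sum>y\<in>N. lam * x y)"
    by (simp add: sum_N power2_eq_square flip: sum_distrib_left)
  also have "\<dots> = d + (\<Sum>y\<in>N. \<mu> y) + P"
    by (simp add: eigen_N sum.distrib d_def P_def)
  finally have lam2: "lam\<^sup>2 = d + (\<Sum>y\<in>N. \<mu> y) + P" .
  have exc: "(\<Sum>y\<in>N. \<Sum>y'\<in>N. a y y' * excess y y') = 2 * (\<Sum>y\<in>N. \<mu> y) - q"
    using sum_swap[where A = N and g = x]
    by (simp add: excess_def algebra_simps sum.distrib sum_subtractf \<mu>_def q_def)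
  have "lam * R = (\<Sum>z\<in>Z. (\<Sum>y\<in>N. a z y * x y) + (\<Sum>z'\<in>Z. a z z' * x z'))"
    unfolding R_def sum_distrib_left
    by (intro sum.cong refl) (simp add: eigen[symmetric] sum_split a_u)
  also have "\<dots> = (\<Sum>y\<in>N. \<Sum>z\<in>Z. a y z * x y) + (\<Sum>z\<in>Z. \<Sum>z'\<in>Z. a z z' * x z')"
    unfolding sum.distrib by (subst sum.swap) (simp add: sym)
  also have "(\<Sum>z\<in>Z. \<Sum>z'\<in>Z. a z z' * x z') \<le> r"
    unfolding r_def by (intro sum_mono) (simp add: a_nonneg x_le_1 mult_left_le)
  also have "(\<Sum>y\<in>N. \<Sum>z\<in>Z. a y z * x y) \<le> (\<Sum>y\<in>N. \<Sum>z\<in>Z. a y z * (x y * x z + (1 - x z)))"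
  proof (intro sum_mono mult_left_mono a_nonneg)
    fix y z
    show "x y \<le> x y * x z + (1 - x z)"
      using mult_nonneg_nonneg[of "1 - x y" "1 - x z"] x_le_1[of y] x_le_1[of z]
      by (simp add: algebra_simps)
  qed
  also have "\<dots> = (\<Sum>y\<in>N. x y * \<rho> y) + (p - P)"
    by (simp add: \<rho>_def p_def P_def algebra_simps sum.distrib sum_subtractf sum_distrib_left)
  finally have R: "lam * R \<le> (\<Sum>y\<in>N. x y * \<rho> y) + (p - P) + r" by simp
  have "P \<le> p" unfolding P_def p_def \<rho>_def
    by (intro sum_mono) (simp add: a_nonneg x_le_1 mult_left_le)
  have "(\<Sum>y\<in>N. x y * (R - \<rho> y)) = lam * R - (\<Sum>y\<in>N. x y * \<rho> y)"
    by (simp add: right_diff_distrib sum_subtractf sum_distrib_right flip: sum_N)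
  also have "\<dots> \<le> 2 * (p - P) + r" using R \<open>P \<le> p\<close> by argo
  also have "\<dots> < 2 * (\<Sum>y\<in>N. \<mu> y) - q" using edges lam2 by argo
  finally show ?thesis using exc by simp
qed

text \<open>
  Only the common neighbours in \<open>Z\<close> are counted twice on the left; there are at most \<open>b - 1\<close> of
  them, each of weight at most \<open>1\<close>, as \<open>u\<close> is a further common neighbour.
\<close>

lemma \<rho>_edge:
  assumes "w \<in> N" "w' \<in> N" "a w w' = 1"
  shows "\<rho> w + \<rho> w' \<le> R + b - 1"
proof -
  have "\<rho> w + \<rho> w' \<le> (\<Sum>z\<in>Z. x z + a w z * a w' z)"
    unfolding \<rho>_def sum.distrib[symmetric]
  proof (rule sum_mono)
    fix z
    show "a w z * x z + a w' z * x z \<le> x z + a w z * a w' z"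
      using a01[of w z] a01[of w' z] x_nonneg[of z] x_le_1[of z] by auto
  qed
  moreover have "1 + (\<Sum>z\<in>Z. a w z * a w' z) \<le> (\<Sum>z\<in>UNIV. a w z * a w' z)"
    using assms by (simp add: sum_split a_u sum_nonneg a_nonneg)
  ultimately show ?thesis using codegree[OF assms(3)] by (simp add: sum.distrib R_def)
qed

lemma degree_N: "y \<in> N \<Longrightarrow> (\<Sum>z\<in>N. a y z) \<le> b"
proof -
  assume "y \<in> N"
  then have "a u y = 1" by (simp add: N_def)
  have "(\<Sum>z\<in>N. a y z) = (\<Sum>z\<in>N. a u z * a y z)" by (simp add: N_def)
  also have "\<dots> \<le> (\<Sum>z\<in>UNIV. a u z * a y z)"
    by (intro sum_mono2) (auto simp: a_nonneg)
  finally show ?thesis using codegree[OF \<open>a u y = 1\<close>] by simp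
qed

text \<open>
  The double count of the deficits. The weights \<open>f\<close>, the positive parts of the excesses, serve both
  estimates at once: their total is at least the total excess, and by
  \<open>f y y' \<le> \<gamma> * x y\<close> the weights at a vertex \<open>y\<close> add up to at most \<open>b * \<gamma> * x y\<close>, so that the
  weighted sum of deficits over edges is controlled by \<open>deficit_less_excess\<close>.
\<close>

theorem eigenvalue_less_4_codegree: "lam < 4 * b"
proof -
  define F where "F = {(y, y'). y \<in> N \<and> y' \<in> N \<and> a y y' = 1}"
  define f where "f y y' = max 0 (excess y y')" for y y'
  define D where "D y = R - \<rho> y" for y
  have D0: "0 \<le> D y" for y by (simp add: D_def \<rho>_le_R)
  have pos: "0 < (\<Sum>y\<in>N. \<Sum>y'\<in>N. a y y' * excess y y')"
    using deficit_less_excess sum_nonneg[of N "\<lambda>y. x y * D y"] D0 x_nonneg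
    by (fastforce simp: D_def)
  have "\<exists>y y'. (y, y') \<in> F \<and> 0 < excess y y'"
  proof (rule ccontr)
    assume *: "\<not> ?thesis"
    have "a y y' * excess y y' \<le> 0" if "y \<in> N" "y' \<in> N" for y y'
      using * that a01[of y y'] by (auto simp: F_def not_less)
    then have "(\<Sum>y\<in>N. \<Sum>y'\<in>N. a y y' * excess y y') \<le> 0" by (intro sum_nonpos) auto
    then show False using pos by simp
  qed
  then obtain y0 y0' where e0: "(y0, y0') \<in> F" "0 < excess y0 y0'" by blast
  define X where "X = Max (x ` fst ` F)"
  have X_ge: "x y \<le> X" if "(y, y') \<in> F" for y y'
    unfolding X_def using imageI[OF imageI[OF that], of x fst] by (intro Max_ge) simp_all
  have F_sym: "(y', y) \<in> F" if "(y, y') \<in> F" for y y'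
    using that sym by (auto simp: F_def)
  define \<phi> where "\<phi> = Max (case_prod excess ` F)"
  have \<phi>_ge: "excess y y' \<le> \<phi>" if "(y, y') \<in> F" for y y'
    unfolding \<phi>_def using imageI[OF that, of "case_prod excess"] by (intro Max_ge) simp_all
  have "X \<in> x ` fst ` F" unfolding X_def using e0 by (intro Max_in) auto
  then obtain v v' where v: "(v, v') \<in> F" "x v = X" by auto
  have "\<phi> \<in> case_prod excess ` F" unfolding \<phi>_def using e0 by (intro Max_in) auto
  then obtain w w' where w: "(w, w') \<in> F" "excess w w' = \<phi>" by auto
  have X01: "0 \<le> X" "X \<le> 1" using v(2) x_nonneg[of v] x_le_1[of v] by auto
  have \<phi>01: "0 < \<phi>" "\<phi> \<le> 1"
    using \<phi>_ge[OF e0(1)] e0(2) w(2) x_le_1[of w] x_le_1[of w'] by (auto simp: excess_def)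
  have \<mu>_le: "\<mu> y \<le> b * X" if "y \<in> N" for y
  proof -
    have "\<mu> y \<le> (\<Sum>z\<in>N. a y z) * X"
      unfolding \<mu>_def sum_distrib_right
    proof (rule sum_mono)
      fix z assume "z \<in> N"
      then show "a y z * x z \<le> a y z * X"
        using a01[of y z] sym[of y z] X_ge[of z y] that by (auto simp: F_def)
    qed
    also have "\<dots> \<le> b * X" using degree_N[OF that] X01 by (intro mult_right_mono) auto
    finally show ?thesis .
  qed
  have FN: "y \<in> N" "y' \<in> N" "a y y' = 1" if "(y, y') \<in> F" for y y'
    using that by (auto simp: F_def)
  have "0 < b"
  proof -
    have "a w w' \<le> (\<Sum>z\<in>N. a w z)"
      by (rule member_le_sum) (use FN[OF w(1)] in \<open>auto simp: a_nonneg\<close>)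
    then show ?thesis using degree_N[of w] FN[OF w(1)] by simp
  qed
  have i: "(lam - b) * X \<le> R + 1"
    using eigen_N[of v] \<mu>_le[of v] \<rho>_le_R[of v] FN[OF v(1)] v(2) by (simp add: algebra_simps)
  have ii: "lam * (1 + \<phi>) \<le> (R + 1) + b + 2 * b * X"
  proof -
    have "1 + \<phi> = x w + x w'" using w(2) by (simp add: excess_def)
    then have "lam * (1 + \<phi>) = lam * x w + lam * x w'" by (simp add: distrib_left)
    also have "\<dots> = 2 + (\<mu> w + \<mu> w') + (\<rho> w + \<rho> w')" using eigen_N FN[OF w(1)] by simp
    finally show ?thesis using \<mu>_le[of w] \<mu>_le[of w'] FN[OF w(1)] \<rho>_edge[of w w'] by simp
  qed
  define \<gamma> where "\<gamma> = \<phi> / (\<phi> + 1 - X)"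
  have "0 < \<gamma>" using \<phi>01 X01 by (simp add: \<gamma>_def)
  have f_le: "f y y' \<le> \<gamma> * x y" if "(y, y') \<in> F" for y y'
  proof (cases "0 < excess y y'")
    case True
    let ?e = "excess y y'"
    \<comment> \<open>As \<open>t / (t + 1 - X)\<close> does not decrease with \<open>t\<close>, the ratio \<open>?e / x y\<close>, at most
      \<open>?e / (?e + 1 - X)\<close>, is largest for \<open>?e = \<phi>\<close>.\<close>
    have "?e + 1 - X \<le> x y" using X_ge[OF F_sym[OF that]] by (simp add: excess_def)
    then have "\<phi> * (?e + 1 - X) \<le> \<phi> * x y" using \<phi>01 by (intro mult_left_mono) auto
    moreover have "?e * (1 - X) \<le> \<phi> * (1 - X)"
      using \<phi>_ge[OF that] X01 by (intro mult_right_mono) auto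
    ultimately have "?e * (\<phi> + 1 - X) \<le> \<phi> * x y" by (simp add: algebra_simps)
    then show ?thesis using True \<phi>01 X01 by (simp add: f_def \<gamma>_def field_simps)
  next
    case False
    then show ?thesis using \<open>0 < \<gamma>\<close> x_nonneg[of y] by (simp add: f_def)
  qed
  have f_sym: "f y y' = f y' y" for y y' by (simp add: f_def excess_def)
  have f0: "0 \<le> f y y'" for y y' by (simp add: f_def)
  define T where "T = (\<Sum>y\<in>N. \<Sum>y'\<in>N. a y y' * f y y')"
  have exc_T: "(\<Sum>y\<in>N. \<Sum>y'\<in>N. a y y' * excess y y') \<le> T"
    unfolding T_def by (intro sum_mono mult_left_mono a_nonneg) (simp add: f_def)
  then have "0 < T" using pos by simp
  have "(R + 1 - b) * T \<le> (\<Sum>y\<in>N. \<Sum>y'\<in>N. a y y' * f y y' * (D y + D y'))"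
    unfolding T_def sum_distrib_left
  proof (intro sum_mono)
    fix y y' assume y: "y \<in> N" "y' \<in> N"
    show "(R + 1 - b) * (a y y' * f y y') \<le> a y y' * f y y' * (D y + D y')"
      using a01[of y y']
    proof
      assume "a y y' = 1"
      then have "R + 1 - b \<le> D y + D y'" using \<rho>_edge[OF y] by (simp add: D_def)
      then have "(R + 1 - b) * f y y' \<le> (D y + D y') * f y y'" by (intro mult_right_mono f0)
      then show ?thesis using \<open>a y y' = 1\<close> by (simp add: mult.commute)
    qed simp
  qed
  also have "\<dots> = 2 * (\<Sum>y\<in>N. D y * (\<Sum>y'\<in>N. a y y' * f y y'))"
  proof -
    have "(\<Sum>y\<in>N. \<Sum>y'\<in>N. a y y' * f y y' * D y') = (\<Sum>y\<in>N. \<Sum>y'\<in>N. a y y' * f y y' * D y)"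
      by (subst sum.swap) (simp add: sym f_sym)
    then show ?thesis
      by (simp add: distrib_left sum.distrib sum_distrib_left mult_ac)
  qed
  also have "\<dots> \<le> 2 * (\<Sum>y\<in>N. D y * (b * \<gamma> * x y))"
  proof (intro mult_left_mono sum_mono D0)
    fix y assume y: "y \<in> N"
    have "(\<Sum>y'\<in>N. a y y' * f y y') \<le> (\<Sum>y'\<in>N. a y y') * (\<gamma> * x y)"
      unfolding sum_distrib_right
    proof (rule sum_mono)
      fix y' assume "y' \<in> N"
      then show "a y y' * f y y' \<le> a y y' * (\<gamma> * x y)"
        using a01[of y y'] f_le[of y y'] y by (auto simp: F_def)
    qed
    also have "\<dots> \<le> b * (\<gamma> * x y)"
      using degree_N[OF y] \<open>0 < \<gamma>\<close> x_nonneg[of y] by (intro mult_right_mono) auto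
    finally show "(\<Sum>y'\<in>N. a y y' * f y y') \<le> b * \<gamma> * x y" by (simp add: mult.assoc)
  qed simp
  also have "\<dots> = 2 * b * \<gamma> * (\<Sum>y\<in>N. x y * D y)"
    by (simp add: sum_distrib_left mult_ac)
  also have "\<dots> < 2 * b * \<gamma> * T"
    using deficit_less_excess exc_T \<open>0 < b\<close> \<open>0 < \<gamma>\<close>
    by (intro mult_strict_left_mono) (auto simp: D_def)
  finally have "R + 1 - b < 2 * b * \<gamma>" using \<open>0 < T\<close> by simp
  then show ?thesis
    using quarter_bound_arith[OF \<open>0 < b\<close> X01(2) \<phi>01 i X01(1) ii] by (simp add: \<gamma>_def)
qed

end

section \<open>The book number of a graph with large spectral radius\<close>

theorem theorem1p5:
  fixes E :: "'a::finite set set"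
  assumes "simple_graph E"
    and "largest_eigenvalue E > sqrt (real (card E))"
  shows "real (bk E) > 1 / 4 * sqrt (real (card E))"
proof -
  define A where "A = adjacency_matrix E"
  define a where "a v w = A $ v $ w" for v w
  have a: "a v w = of_bool ({v, w} \<in> E)" for v w
    by (simp add: a_def A_def adjacency_matrix_def)
  have "transpose A = A"
    by (simp add: A_def adjacency_matrix_def transpose_def vec_eq_iff insert_commute)
  moreover have "0 \<le> A $ v $ w" for v w using a[of v w] by (simp add: a_def)
  ultimately obtain c z where z: "z \<noteq> 0" "\<And>v. 0 \<le> z $ v" "A *v z = c *\<^sub>R z"
    and c: "\<And>d. is_eigenvalue A d \<Longrightarrow> d \<le> c"
    using nonneg_eigenvector_exists by metis
  have "is_eigenvalue A (largest_eigenvalue E)"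
  proof -
    have "is_eigenvalue A c" using z by (auto simp: is_eigenvalue_def)
    then have "Max {d. is_eigenvalue A d} \<in> {d. is_eigenvalue A d}"
      using finite_eigenvalues_symmetric[OF \<open>transpose A = A\<close>] by (intro Max_in) auto
    then show ?thesis by (simp add: largest_eigenvalue_def A_def)
  qed
  then have sqrt_less: "sqrt (real (card E)) < c" using c assms(2) by fastforce
  define M where "M = Max (range (($) z))"
  have z_le: "z $ v \<le> M" for v unfolding M_def by (intro Max_ge) auto
  have "M \<in> range (($) z)" unfolding M_def by (intro Max_in) auto
  then obtain u where u: "z $ u = M" by auto
  have "M \<noteq> 0"
  proof
    assume "M = 0"
    then have "z $ v = 0" for v using z(2)[of v] z_le[of v] by simp
    then show False using z(1) by (simp add: vec_eq_iff)
  qed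
  then have "0 < M" using z(2)[of u] u by simp
  define x where "x v = z $ v / M" for v
  have "perron_graph a x c (real (bk E)) u"
  proof
    fix v w
    show "a v w = 0 \<or> a v w = 1" by (simp add: a)
    show "a v w = a w v" by (simp add: a insert_commute)
    show "a v v = 0" using assms(1) by (force simp: a simple_graph_def)
    show "0 \<le> x v" "x v \<le> 1" "x u = 1"
      using z(2)[of v] z_le[of v] u \<open>0 < M\<close> by (simp_all add: x_def)
    have "(A *v z) $ v = c * z $ v" by (simp add: z(3))
    then show "(\<Sum>w\<in>UNIV. a v w * x w) = c * x v"
      by (simp add: matrix_vector_mult_def a_def x_def flip: sum_divide_distrib)
    show "(\<Sum>y\<in>UNIV. a v y * a w y) \<le> real (bk E)" if "a v w = 1"
    proof -
      have "(\<Sum>y\<in>UNIV. a v y * a w y) = (\<Sum>y\<in>UNIV. of_bool ({v, y} \<in> E \<and> {w, y} \<in> E))"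
        by (intro sum.cong) (simp_all add: a)
      also have "\<dots> = real (card {y. {v, y} \<in> E \<and> {w, y} \<in> E})"
        by (simp add: of_bool_def sum.If_cases)
      also have "\<dots> \<le> real (bk E)"
        using codegree_le_bk[OF assms(1), of v w] that by (simp add: a)
      finally show ?thesis .
    qed
    have "real (card E) = (sqrt (real (card E)))\<^sup>2" by simp
    also have "\<dots> < c\<^sup>2" using sqrt_less by (intro power_strict_mono) auto
    finally show "(\<Sum>v\<in>UNIV. \<Sum>w\<in>UNIV. a v w) < 2 * c\<^sup>2"
      by (simp only: a sum_adjacency[OF assms(1)])
  qed
  then have "c < 4 * real (bk E)" by (rule perron_graph.eigenvalue_less_4_codegree)
  then show ?thesis using sqrt_less by simp
qed

end
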